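(* Let $0<r<R$ and let $C,C'\subset\mathbb{R}^{n+1}$ be convex bodies such that $\overline{B}(0,2r)\subset C\cap C'$ and $C\cup C'\subset\overline{B}(0,R)$. Let $\rho=\rho(C,\cdot)$ and $\rho'=\rho(C',\cdot)$ be the radial functions of $C$ and $C'$, and let $f:C\to C'$ be the bilipschitz map defined by $$f(x)=\begin{cases} x, & |x|\le r,\\[4pt] \displaystyle r\,\frac{x}{|x|}+(|x|-r)\,\frac{\rho'\big(\frac{x}{|x|}\big)-r}{\rho\big(\frac{x}{|x|}\big)-r}\,\frac{x}{|x|}, & |x|\ge r.\end{cases}$$ Then $$1\le \mathrm{Lip}(f),\ \mathrm{Lip}(f^{-1})\le 1+\frac{R}{r}\Big(\frac{R}{r}-1\Big)\Big(\frac{R^2}{r^2}+1\Big).$$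
   Context: A convex body in $\mathbb{R}^{n+1}$ is a compact convex set with non-empty interior. $\overline{B}(x,s)$ is the closed Euclidean ball of center $x$ and radius $s$. If $C$ is a convex body with $0$ in its interior, its radial function $\rho(C,\cdot):\mathbb{S}^n\to\mathbb{R}$ is $\rho(C,u)=\max\{\lambda\ge 0:\lambda u\in C\}$. $\mathrm{Lip}(f)$ is the smallest Lipschitz constant of $f$ with respect to the Euclidean distance; a bijection $f$ is bilipschitz if $f$ and $f^{-1}$ are Lipschitz. *)

theory Defs
  imports "HOL-Analysis.Analysis"
begin

definition convex_body :: "'a::euclidean_space set \<Rightarrow> bool"
  where "convex_body C \<longleftrightarrow> compact C \<and> convex C \<and> interior C \<noteq> {}"

text \<open>The maximum is rendered by \<^const>\<open>Greatest\<close>. It is attained when \<open>C\<close> is a convex body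
  with \<open>0\<close> in its interior and \<open>u\<close> is a unit vector.\<close>
definition radial_function :: "'a::euclidean_space set \<Rightarrow> 'a \<Rightarrow> real"
  where "radial_function C u = (GREATEST l. 0 \<le> l \<and> l *\<^sub>R u \<in> C)"

text \<open>The least constant exists whenever \<open>f\<close> is Lipschitz on \<open>S\<close>; otherwise the value is
  unspecified.\<close>
definition Lip :: "'a::metric_space set \<Rightarrow> ('a \<Rightarrow> 'b::metric_space) \<Rightarrow> real"
  where "Lip S f = (LEAST L. L-lipschitz_on S f)"

definition bilipschitz :: "'a::metric_space set \<Rightarrow> 'b::metric_space set \<Rightarrow> ('a \<Rightarrow> 'b) \<Rightarrow> bool"
  where "bilipschitz S T f \<longleftrightarrow>
    bij_betw f S T \<and> (\<exists>L. L-lipschitz_on S f) \<and> (\<exists>M. M-lipschitz_on T (inv_into S f))"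

text \<open>The second branch also gives \<open>x\<close> when \<open>norm x = r\<close> and \<open>r > 0\<close>, so the two cases of the
  definition may overlap there.\<close>
definition radial_map :: "real \<Rightarrow> 'a::euclidean_space set \<Rightarrow> 'a set \<Rightarrow> 'a \<Rightarrow> 'a"
  where "radial_map r C C' x =
    (if norm x \<le> r then x
     else let u = x /\<^sub>R norm x in
       r *\<^sub>R u + ((norm x - r) * ((radial_function C' u - r) / (radial_function C u - r))) *\<^sub>R u)"

end

theory Submission
  imports Defs
begin

text \<open>
  The map \<open>f\<close> preserves rays from the origin, and on the ray through the unit vector \<open>u\<close> it is the
  identity up to distance \<open>r\<close> and then affine with slope
  \<open>m(u) = (\<rho>'(u) - r) / (\<rho>(u) - r)\<close>. Exchanging the two bodies replaces every slope by its
  reciprocal, so \<open>f\<^sup>-\<^sup>1\<close> is the map of the same kind from \<open>C'\<close> to \<open>C\<close>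
  (lemma \<open>radial_map_inverse\<close>), and only one Lipschitz estimate is needed.

  The geometric input is that convexity controls the variation of the radial function: \<open>1 / \<rho>\<close> is
  the restriction of the gauge of \<open>C\<close>, which is subadditive and at most \<open>norm / (2 * r)\<close>. Hence
  \<open>\<rho>\<close> is Lipschitz on the unit sphere with constant \<open>R\<^sup>2 / (2 * r)\<close>
  (lemmas \<open>inverse_radial_function_le\<close> and \<open>radial_function_lipschitz\<close>).

  For two points \<open>s u\<close> and \<open>t v\<close> at distance at least \<open>r\<close> from \<open>0\<close>, the difference of the images
  splits into a change of the distance along a fixed ray, a change of slope, and a change of
  direction. With \<open>a = R / r\<close> the three terms contribute at most \<open>a - 1\<close>, \<open>a\<^sup>2 (a - 1)\<close> and \<open>a\<close> to
  the Lipschitz constant. Their sum is at most \<open>1 + a (a - 1) (a\<^sup>2 + 1)\<close> because \<open>a \<ge> 2\<close>. If one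
  point lies in the ball of radius \<open>r\<close>, moving the other one to the sphere of radius \<open>r\<close> gives the
  constant \<open>a\<close>. The lower bound holds because \<open>f\<close> and its inverse fix a ball pointwise.
\<close>

section \<open>The least Lipschitz constant\<close>

text \<open>The admissible constants form a closed set bounded below by \<open>0\<close>, so their infimum is
  admissible and is the value of \<^const>\<open>Lip\<close>.\<close>

lemma Lip_attained:
  assumes L: "L-lipschitz_on S f"
  shows "(Lip S f)-lipschitz_on S f" and "Lip S f \<le> L"
proof -
  define A where "A = {L. L-lipschitz_on S f}"
  have ne: "A \<noteq> {}" and bdd: "bdd_below A"
    using L by (auto simp: A_def intro!: bdd_belowI[of _ 0] dest: lipschitz_on_nonneg)
  have "dist (f x) (f y) \<le> Inf A * dist x y" if "x \<in> S" "y \<in> S" for x y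
  proof (cases "x = y")
    case False
    have "dist (f x) (f y) / dist x y \<le> K" if "K \<in> A" for K
      using that lipschitz_onD[of K S f x y] \<open>x \<in> S\<close> \<open>y \<in> S\<close> False
      by (simp add: A_def divide_le_eq)
    then have "dist (f x) (f y) / dist x y \<le> Inf A"
      using ne by (intro cInf_greatest) auto
    then show ?thesis
      using False by (simp add: divide_le_eq)
  qed simp
  moreover have "0 \<le> Inf A"
    using ne by (intro cInf_greatest) (auto simp: A_def dest: lipschitz_on_nonneg)
  ultimately have adm: "(Inf A)-lipschitz_on S f"
    by (intro lipschitz_onI)
  have least: "Inf A \<le> K" if "K-lipschitz_on S f" for K
    using that bdd by (intro cInf_lower) (auto simp: A_def)
  have "Lip S f = Inf A"
    unfolding Lip_def using adm least by (intro Least_equality)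
  then show "(Lip S f)-lipschitz_on S f" and "Lip S f \<le> L"
    using adm least[OF L] by simp_all
qed

lemma one_le_Lip_if_fixes_ball:
  fixes f :: "'a::euclidean_space \<Rightarrow> 'a"
  assumes L: "L-lipschitz_on S f" and "0 < r" and sub: "cball 0 r \<subseteq> S"
    and id_on_ball: "\<And>x. norm x \<le> r \<Longrightarrow> f x = x"
  shows "1 \<le> Lip S f"
proof -
  obtain b :: 'a where b: "norm b = r"
    using vector_choose_size[of r] \<open>0 < r\<close> by auto
  have "b \<in> S" "0 \<in> S"
    using sub b \<open>0 < r\<close> by auto
  then have "dist (f b) (f 0) \<le> Lip S f * dist b 0"
    by (intro lipschitz_onD[OF Lip_attained(1)[OF L]])
  then show ?thesis
    using b id_on_ball[of b] id_on_ball[of 0] \<open>0 < r\<close> by simp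
qed

section \<open>Radial functions of convex bodies\<close>

lemma norm_scaleR_sgn: "norm x *\<^sub>R sgn x = (x::'a::real_normed_vector)"
  by (cases "x = 0") (simp_all add: sgn_div_norm)

lemma
  fixes C :: "'a::euclidean_space set"
  assumes "compact C" and "0 < d" and ball: "cball 0 d \<subseteq> C" and u: "norm u = 1"
  shows radial_function_mem: "radial_function C u *\<^sub>R u \<in> C"
    and radial_function_upper: "\<And>l. 0 \<le> l \<Longrightarrow> l *\<^sub>R u \<in> C \<Longrightarrow> l \<le> radial_function C u"
    and radial_function_ge: "d \<le> radial_function C u"
proof -
  define A where "A = {l. 0 \<le> l \<and> l *\<^sub>R u \<in> C}"
  obtain B where B: "\<And>x. x \<in> C \<Longrightarrow> norm x \<le> B"
    using compact_imp_bounded[OF \<open>compact C\<close>] by (auto simp: bounded_iff)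
  have "A \<subseteq> {0..B}"
    using B u by (force simp: A_def)
  then have "bounded A"
    using bounded_subset bounded_closed_interval by blast
  moreover have "closed A"
  proof -
    have "closed ((\<lambda>l. l *\<^sub>R u) -` C)"
      using compact_imp_closed[OF \<open>compact C\<close>] by (intro closed_vimage continuous_intros)
    moreover have "A = {0..} \<inter> (\<lambda>l. l *\<^sub>R u) -` C"
      by (auto simp: A_def)
    ultimately show ?thesis
      by (simp add: closed_Int)
  qed
  moreover have d: "d \<in> A"
    using ball u \<open>0 < d\<close> by (auto simp: A_def)
  ultimately obtain m where m: "m \<in> A" "\<And>l. l \<in> A \<Longrightarrow> l \<le> m"
    using compact_attains_sup[of A] by (auto simp: compact_eq_bounded_closed)
  have "radial_function C u = m"
    unfolding radial_function_def using m by (intro Greatest_equality) (auto simp: A_def)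
  then show "radial_function C u *\<^sub>R u \<in> C" "d \<le> radial_function C u"
    "\<And>l. 0 \<le> l \<Longrightarrow> l *\<^sub>R u \<in> C \<Longrightarrow> l \<le> radial_function C u"
    using m d by (auto simp: A_def)
qed

lemma radial_function_le:
  fixes C :: "'a::euclidean_space set"
  assumes "compact C" and "0 < d" and "cball 0 d \<subseteq> C" and "C \<subseteq> cball 0 R" and "norm u = 1"
  shows "radial_function C u \<le> R"
proof -
  have "norm (radial_function C u *\<^sub>R u) \<le> R"
    using radial_function_mem[OF assms(1-3,5)] assms(4) by auto
  then show ?thesis
    using assms(5) by simp
qed

lemma norm_le_radial_function:
  fixes C :: "'a::euclidean_space set"
  assumes "compact C" and "0 < d" and "cball 0 d \<subseteq> C" and "x \<in> C" and "x \<noteq> 0"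
  shows "norm x \<le> radial_function C (sgn x)"
proof (rule radial_function_upper[OF assms(1-3)])
  show "norm x *\<^sub>R sgn x \<in> C"
    using assms(4,5) by (simp add: sgn_div_norm)
qed (use assms(5) in \<open>simp_all add: norm_sgn\<close>)

lemma mem_if_le_radial_function:
  fixes C :: "'a::euclidean_space set"
  assumes "compact C" and "convex C" and "0 < d" and "cball 0 d \<subseteq> C" and "norm u = 1"
    and "0 \<le> l" and "l \<le> radial_function C u"
  shows "l *\<^sub>R u \<in> C"
proof -
  let ?\<rho> = "radial_function C u"
  have pos: "0 < ?\<rho>"
    using radial_function_ge[OF assms(1,3,4,5)] assms(3) by simp
  have "0 \<in> C"
    using assms(3,4) by auto
  then have "(1 - l / ?\<rho>) *\<^sub>R 0 + (l / ?\<rho>) *\<^sub>R (?\<rho> *\<^sub>R u) \<in> C"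
    using radial_function_mem[OF assms(1,3,4,5)] pos assms(2,6,7)
    by (intro convexD) auto
  then show ?thesis
    using pos by simp
qed

text \<open>This is subadditivity of the gauge of \<open>C\<close>: the vector \<open>v = u + (v - u)\<close> is a sum of a multiple
  of the boundary point on the ray through \<open>u\<close> and a multiple of a point of the inscribed ball, so
  dividing it by the sum of the two coefficients produces a convex combination.\<close>

lemma inverse_radial_function_le:
  fixes C :: "'a::euclidean_space set"
  assumes "compact C" and "convex C" and "0 < d" and "cball 0 d \<subseteq> C"
    and u: "norm u = 1" and v: "norm v = 1"
  shows "1 / radial_function C v \<le> 1 / radial_function C u + norm (u - v) / d"
proof -
  let ?\<rho> = "radial_function C u" and ?b = "norm (u - v) / d"
  define k where "k = 1 / ?\<rho> + ?b"
  note ge = radial_function_ge[OF assms(1,3,4)]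
  have pos: "0 < ?\<rho>" "0 < radial_function C v"
    using ge[OF u] ge[OF v] assms(3) by simp_all
  have "0 \<le> ?b"
    using assms(3) by simp
  then have "0 < k"
    using pos assms(3) by (auto simp: k_def intro!: add_pos_nonneg)
  have "d *\<^sub>R sgn (v - u) \<in> C"
    using assms(3,4) by (auto simp: norm_sgn)
  then have "(1 / ?\<rho> / k) *\<^sub>R (?\<rho> *\<^sub>R u) + (?b / k) *\<^sub>R (d *\<^sub>R sgn (v - u)) \<in> C"
  proof (intro convexD[OF assms(2)] radial_function_mem[OF assms(1,3,4) u])
    show "1 / ?\<rho> / k + ?b / k = 1"
      using \<open>0 < k\<close> by (simp only: k_def flip: add_divide_distrib) simp
    show "0 \<le> 1 / ?\<rho> / k" "0 \<le> ?b / k"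
      using pos \<open>0 < k\<close> \<open>0 \<le> ?b\<close> by (simp_all only: divide_nonneg_pos zero_le_one)
  qed
  moreover have "norm (u - v) *\<^sub>R sgn (v - u) = v - u"
    using norm_scaleR_sgn[of "v - u"] by (simp add: norm_minus_commute)
  then have "(1 / k) *\<^sub>R v = (1 / k) *\<^sub>R u + (1 / k) *\<^sub>R (norm (u - v) *\<^sub>R sgn (v - u))"
    by (simp flip: scaleR_add_right)
  then have "(1 / k) *\<^sub>R v
      = (1 / ?\<rho> / k) *\<^sub>R (?\<rho> *\<^sub>R u) + (?b / k) *\<^sub>R (d *\<^sub>R sgn (v - u))"
    using pos assms(3) by simp
  ultimately have "(1 / k) *\<^sub>R v \<in> C"
    by simp
  then have "1 / k \<le> radial_function C v"
    using radial_function_upper[OF assms(1,3,4) v, of "1 / k"] \<open>0 < k\<close> by simp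
  then show ?thesis
    using \<open>0 < k\<close> pos by (simp add: k_def[symmetric] divide_le_eq le_divide_eq field_simps)
qed

lemma radial_function_lipschitz:
  fixes C :: "'a::euclidean_space set"
  assumes "compact C" and "convex C" and "0 < d" and "cball 0 d \<subseteq> C" and "C \<subseteq> cball 0 R"
    and u: "norm u = 1" and v: "norm v = 1"
  shows "\<bar>radial_function C u - radial_function C v\<bar> \<le> R\<^sup>2 / d * norm (u - v)"
proof -
  have one_sided: "radial_function C x - radial_function C y \<le> R\<^sup>2 / d * norm (x - y)"
    if x: "norm x = 1" and y: "norm y = 1" for x y
  proof -
    let ?p = "radial_function C x" and ?q = "radial_function C y"
    note ge = radial_function_ge[OF assms(1,3,4)] and le = radial_function_le[OF assms(1,3,4,5)]
    have pos: "0 < ?p" "0 < ?q"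
      using ge[OF x] ge[OF y] assms(3) by simp_all
    have "1 / ?q - 1 / ?p \<le> norm (x - y) / d"
      using inverse_radial_function_le[OF assms(1-4) x y] by simp
    then have "(?p * ?q) * (1 / ?q - 1 / ?p) \<le> (?p * ?q) * (norm (x - y) / d)"
      using pos by (intro mult_left_mono) simp_all
    then have "?p - ?q \<le> (?p * ?q) * (norm (x - y) / d)"
      using pos by (simp add: right_diff_distrib)
    also have "\<dots> \<le> R\<^sup>2 * (norm (x - y) / d)"
      using pos le[OF x] le[OF y] assms(3)
      by (intro mult_right_mono) (auto simp: power2_eq_square intro!: mult_mono)
    finally show ?thesis
      by simp
  qed
  show ?thesis
    using one_sided[OF u v] one_sided[OF v u] by (simp add: norm_minus_commute abs_le_iff)
qed

section \<open>Polar coordinates\<close>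

lemma norm_diff_sgn_le:
  fixes x y :: "'a::real_inner"
  assumes "0 < r" and "r \<le> norm x" and "r \<le> norm y"
  shows "r * norm (sgn x - sgn y) \<le> norm (x - y)"
proof -
  let ?s = "norm x" and ?t = "norm y"
  let ?c = "sgn x \<bullet> sgn y"
  have unit: "norm (sgn x) = 1" "norm (sgn y) = 1"
    using assms by (auto simp: norm_sgn)
  have polar: "x = ?s *\<^sub>R sgn x" "y = ?t *\<^sub>R sgn y"
    by (simp_all add: norm_scaleR_sgn)
  have xy: "x \<bullet> y = ?s * ?t * ?c"
    by (subst (1) polar(1), subst (1) polar(2)) simp
  have "(norm (sgn x - sgn y))\<^sup>2 = 2 * (1 - ?c)"
    using unit by (simp add: power2_norm_eq_inner norm_eq_1 inner_diff inner_commute)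
  moreover have "?c \<le> 1"
    using norm_cauchy_schwarz[of "sgn x" "sgn y"] unit by simp
  moreover have "r * r \<le> ?s * ?t"
    using assms by (intro mult_mono) auto
  ultimately have "r\<^sup>2 * (norm (sgn x - sgn y))\<^sup>2 \<le> ?s * ?t * (2 * (1 - ?c))"
    by (auto simp: power2_eq_square intro!: mult_right_mono)
  also have "\<dots> \<le> (?s - ?t)\<^sup>2 + ?s * ?t * (2 * (1 - ?c))"
    by simp
  also have "\<dots> = (norm (x - y))\<^sup>2"
    using xy dot_norm_neg[of x y] by (simp add: power2_diff algebra_simps)
  finally have "(r * norm (sgn x - sgn y))\<^sup>2 \<le> (norm (x - y))\<^sup>2"
    by (simp add: power_mult_distrib)
  then show ?thesis
    by (rule power2_le_imp_le) simp
qed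

text \<open>The point \<open>r *\<^sub>R sgn y\<close> is the nearest point to \<open>y\<close> in the ball of radius \<open>r\<close>, so it is at
  least as close as \<open>y\<close> to every point of that ball.\<close>

lemma norm_diff_project_ball_le:
  fixes x y :: "'a::real_inner"
  assumes "0 < r" and "norm x \<le> r" and "r \<le> norm y"
  shows "norm (x - r *\<^sub>R sgn y) \<le> norm (x - y)"
proof -
  let ?t = "norm y"
  have unit: "norm (sgn y) = 1"
    using assms by (auto simp: norm_sgn)
  have polar: "y = ?t *\<^sub>R sgn y"
    by (simp add: norm_scaleR_sgn)
  have "x \<bullet> sgn y \<le> r"
    using norm_cauchy_schwarz[of x "sgn y"] unit assms by simp
  then have "0 \<le> (?t - r) * (?t + r - 2 * (x \<bullet> sgn y))"
    using assms by (intro mult_nonneg_nonneg) auto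
  moreover have sq: "(norm (x - c *\<^sub>R sgn y))\<^sup>2 = (norm x)\<^sup>2 + c\<^sup>2 - 2 * c * (x \<bullet> sgn y)" for c
    using dot_norm_neg[of x "c *\<^sub>R sgn y"] unit by simp
  ultimately have "(norm (x - r *\<^sub>R sgn y))\<^sup>2 \<le> (norm (x - ?t *\<^sub>R sgn y))\<^sup>2"
    unfolding sq by (simp add: power2_eq_square algebra_simps)
  then have "(norm (x - r *\<^sub>R sgn y))\<^sup>2 \<le> (norm (x - y))\<^sup>2"
    by (simp flip: polar)
  then show ?thesis
    by (rule power2_le_imp_le) simp
qed

section \<open>The radial map\<close>

definition radial_slope :: "real \<Rightarrow> 'a::euclidean_space set \<Rightarrow> 'a set \<Rightarrow> 'a \<Rightarrow> real"
  where "radial_slope r C C' u = (radial_function C' u - r) / (radial_function C u - r)"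

lemma radial_map_inside: "norm x \<le> r \<Longrightarrow> radial_map r C C' x = x"
  by (simp add: radial_map_def)

lemma radial_map_outside:
  assumes "0 < r" and "r \<le> norm x"
  shows "radial_map r C C' x = (r + (norm x - r) * radial_slope r C C' (sgn x)) *\<^sub>R sgn x"
proof (cases "norm x = r")
  case True
  then show ?thesis
    using norm_scaleR_sgn[of x] by (simp add: radial_map_def)
next
  case False
  then show ?thesis
    using assms by (simp add: radial_map_def radial_slope_def Let_def scaleR_add_left flip: sgn_div_norm)
qed

text \<open>Two bodies between the balls of radii \<open>2 * r\<close> and \<open>R\<close>. The hypotheses are symmetric in the two
  bodies, so each fact about the map from \<open>C\<close> to \<open>C'\<close> also holds for the map from \<open>C'\<close> to \<open>C\<close>.\<close>

locale pinched_bodies =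
  fixes C C' :: "'a::euclidean_space set" and r R :: real
  assumes r_pos: "0 < r"
    and compact: "compact C" "compact C'"
    and convex: "convex C" "convex C'"
    and inner_ball: "cball 0 (2 * r) \<subseteq> C" "cball 0 (2 * r) \<subseteq> C'"
    and outer_ball: "C \<subseteq> cball 0 R" "C' \<subseteq> cball 0 R"
begin

abbreviation "f \<equiv> radial_map r C C'"
abbreviation "\<rho> \<equiv> radial_function C"
abbreviation "\<rho>' \<equiv> radial_function C'"
abbreviation "m \<equiv> radial_slope r C C'"

lemma swap: "pinched_bodies C' C r R"
  using r_pos compact convex inner_ball outer_ball by unfold_locales auto

lemma radial_bounds:
  assumes "norm u = 1"
  shows "2 * r \<le> \<rho> u" "\<rho> u \<le> R" "2 * r \<le> \<rho>' u" "\<rho>' u \<le> R"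
  using assms r_pos compact inner_ball outer_ball
  by (auto intro!: radial_function_ge radial_function_le[of _ "2 * r"])

lemma slope_pos: "norm u = 1 \<Longrightarrow> 0 < m u"
  using radial_bounds[of u] r_pos by (simp add: radial_slope_def)

lemma slope_le: "norm u = 1 \<Longrightarrow> m u \<le> R / r - 1"
proof -
  assume "norm u = 1"
  then have "m u \<le> (R - r) / r"
    using radial_bounds[of u] r_pos unfolding radial_slope_def by (intro frac_le) auto
  then show ?thesis
    using r_pos by (simp add: diff_divide_distrib)
qed

lemma two_le_ratio: "2 \<le> R / r"
proof -
  obtain u :: 'a where "norm u = 1"
    using vector_choose_size[of 1] by auto
  then have "2 * r \<le> R"
    using radial_bounds[of u] by linarith
  then show ?thesis
    using r_pos by (simp add: le_divide_eq)
qed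

lemma
  assumes "r \<le> norm x"
  shows norm_radial_map: "norm (f x) = r + (norm x - r) * m (sgn x)"
    and sgn_radial_map: "sgn (f x) = sgn x"
proof -
  have unit: "norm (sgn x) = 1"
    using assms r_pos by (auto simp: norm_sgn)
  have "0 < r + (norm x - r) * m (sgn x)"
    using slope_pos[OF unit] assms r_pos by (intro add_pos_nonneg) auto
  then show "norm (f x) = r + (norm x - r) * m (sgn x)" "sgn (f x) = sgn x"
    using unit assms r_pos sgn_div_norm[of "sgn x"]
    by (simp_all add: radial_map_outside sgn_scaleR)
qed

lemma radial_map_inverse: "radial_map r C' C (f x) = x"
proof (cases "norm x \<le> r")
  case False
  then have x: "r \<le> norm x"
    by simp
  then have unit: "norm (sgn x) = 1"
    using r_pos by (auto simp: norm_sgn)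
  have "m (sgn x) * radial_slope r C' C (sgn x) = 1"
    using radial_bounds[OF unit] r_pos by (simp add: radial_slope_def)
  moreover have "r \<le> norm (f x)"
    using x slope_pos[OF unit] by (simp add: norm_radial_map)
  ultimately have "radial_map r C' C (f x) = norm x *\<^sub>R sgn x"
    using x r_pos by (simp add: radial_map_outside[of r "f x"] norm_radial_map sgn_radial_map mult.assoc)
  then show ?thesis
    by (simp add: norm_scaleR_sgn)
qed (simp add: radial_map_inside)

lemma norm_radial_map_le:
  assumes "x \<in> C" and "r \<le> norm x"
  shows "norm (f x) \<le> \<rho>' (sgn x)"
proof -
  have unit: "norm (sgn x) = 1" and "x \<noteq> 0"
    using assms r_pos by (auto simp: norm_sgn)
  have "norm x - r \<le> \<rho> (sgn x) - r"
    using norm_le_radial_function[of C "2 * r" x] compact inner_ball r_pos assms \<open>x \<noteq> 0\<close> by simp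
  then have "(norm x - r) * m (sgn x) \<le> (\<rho> (sgn x) - r) * m (sgn x)"
    using slope_pos[OF unit] by (intro mult_right_mono) auto
  also have "\<dots> = \<rho>' (sgn x) - r"
    using radial_bounds[OF unit] r_pos by (simp add: radial_slope_def)
  finally show ?thesis
    using assms by (simp add: norm_radial_map)
qed

lemma radial_map_mem:
  assumes "x \<in> C"
  shows "f x \<in> C'"
proof (cases "norm x \<le> r")
  case True
  then show ?thesis
    using inner_ball r_pos by (auto simp: radial_map_inside)
next
  case False
  then have x: "r \<le> norm x"
    by simp
  then have unit: "norm (sgn x) = 1" and "f x \<noteq> 0"
    using r_pos sgn_radial_map[OF x] by (auto simp: norm_sgn sgn_zero_iff)
  have "norm (f x) *\<^sub>R sgn x \<in> C'"
    using norm_radial_map_le[OF assms x] compact convex inner_ball r_pos unit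
    by (intro mem_if_le_radial_function[of _ "2 * r"]) auto
  then show ?thesis
    using norm_scaleR_sgn[of "f x"] by (simp add: sgn_radial_map[OF x])
qed

text \<open>The difference of the two quotients is split into a change of the numerator and a change of the
  denominator. In the second part the product of both denominators occurs; the factor
  \<open>norm y - r \<le> \<rho> (sgn y) - r\<close> absorbs one of them, so that only one division by a quantity of
  size at least \<open>r\<close> remains in each part.\<close>

lemma slope_variation:
  assumes y: "y \<in> C" "r \<le> norm y" and u: "norm u = 1"
  shows "(norm y - r) * \<bar>m u - m (sgn y)\<bar> \<le> (R / r - 1) * (R\<^sup>2 / r) * norm (u - sgn y)"
proof -
  define v where "v = sgn y"
  define D where "D = R\<^sup>2 / (2 * r) * norm (u - v)"
  have v: "norm v = 1" and "y \<noteq> 0"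
    using y r_pos by (auto simp: v_def norm_sgn)
  note bu = radial_bounds[OF u] and bv = radial_bounds[OF v]
  have t: "norm y \<le> \<rho> v"
    using norm_le_radial_function[of C "2 * r" y] compact inner_ball r_pos y \<open>y \<noteq> 0\<close>
    by (simp add: v_def)
  have lip: "\<bar>\<rho> u - \<rho> v\<bar> \<le> D" "\<bar>\<rho>' u - \<rho>' v\<bar> \<le> D"
    unfolding D_def using compact convex inner_ball outer_ball r_pos u v
    by (intro radial_function_lipschitz; simp)+
  have pos: "0 < \<rho> u - r" "0 < \<rho> v - r"
    using bu bv r_pos by auto
  have "m u - m v = (\<rho>' u - \<rho>' v) / (\<rho> u - r)
      + (\<rho>' v - r) * (\<rho> v - \<rho> u) / ((\<rho> u - r) * (\<rho> v - r))"
  proof -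
    have "p' / p - q' / q = (p' - q') / p + q' * (q - p) / (p * q)"
      if "0 < p" "0 < q" for p q p' q' :: real
      using that by (simp add: field_simps)
    from this[OF pos, of "\<rho>' u - r" "\<rho>' v - r"] show ?thesis
      by (simp add: radial_slope_def)
  qed
  then have "(norm y - r) * (m u - m v)
      = (norm y - r) / (\<rho> u - r) * (\<rho>' u - \<rho>' v)
      + (norm y - r) / (\<rho> v - r) * ((\<rho>' v - r) / (\<rho> u - r)) * (\<rho> v - \<rho> u)"
    by (simp add: distrib_left mult_ac)
  then have "\<bar>(norm y - r) * (m u - m v)\<bar>
      \<le> \<bar>(norm y - r) / (\<rho> u - r) * (\<rho>' u - \<rho>' v)\<bar>
      + \<bar>(norm y - r) / (\<rho> v - r) * ((\<rho>' v - r) / (\<rho> u - r)) * (\<rho> v - \<rho> u)\<bar>"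
    by (simp only: abs_triangle_ineq)
  also have "\<dots> = (norm y - r) / (\<rho> u - r) * \<bar>\<rho>' u - \<rho>' v\<bar>
      + (norm y - r) / (\<rho> v - r) * ((\<rho>' v - r) / (\<rho> u - r)) * \<bar>\<rho> u - \<rho> v\<bar>"
    using y pos bv r_pos by (simp add: abs_mult abs_minus_commute)
  also have "\<dots> \<le> (R - r) / r * D + 1 * ((R - r) / r) * D"
    using lip y t pos bu bv r_pos
    by (intro add_mono mult_mono frac_le) (auto simp: divide_le_eq)
  also have "\<dots> = (R / r - 1) * (R\<^sup>2 / r) * norm (u - v)"
    using r_pos by (simp add: D_def field_simps)
  finally show ?thesis
    using y by (simp add: v_def abs_mult)
qed

lemma radial_map_lipschitz_outside:
  assumes x: "x \<in> C" "r \<le> norm x" and y: "y \<in> C" "r \<le> norm y"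
  shows "norm (f x - f y) \<le> (R / r - 1 + (R / r - 1) * (R / r)\<^sup>2 + R / r) * norm (x - y)"
proof -
  define u v where "u = sgn x" and "v = sgn y"
  have unit: "norm u = 1" "norm v = 1"
    using x y r_pos by (auto simp: u_def v_def norm_sgn)
  have angle: "norm (u - v) \<le> norm (x - y) / r"
    using norm_diff_sgn_le[of r x y] x y r_pos by (simp add: u_def v_def le_divide_eq mult.commute)
  have a: "2 \<le> R / r"
    by (rule two_le_ratio)
  have "R > 0"
    using a r_pos by (simp add: le_divide_eq)
  \<comment> \<open>The change of direction is weighted by \<open>norm (f y)\<close>, which is bounded by \<open>R\<close>, and the change
      of slope by \<open>norm y - r\<close>, as \<open>slope_variation\<close> requires.\<close>
  have "f x - f y = ((norm x - norm y) * m u) *\<^sub>R u + ((norm y - r) * (m u - m v)) *\<^sub>R u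
      + norm (f y) *\<^sub>R (u - v)"
    using x y r_pos unfolding norm_radial_map[OF y(2)]
    by (simp add: radial_map_outside u_def v_def algebra_simps)
  then have "norm (f x - f y)
      \<le> norm (((norm x - norm y) * m u) *\<^sub>R u) + norm (((norm y - r) * (m u - m v)) *\<^sub>R u)
      + norm (norm (f y) *\<^sub>R (u - v))"
    by (simp only:) (intro norm_triangle_ineq norm_triangle_le add_right_mono)
  also have "\<dots> = m u * \<bar>norm x - norm y\<bar> + (norm y - r) * \<bar>m u - m v\<bar>
      + norm (f y) * norm (u - v)"
    using unit y slope_pos[of u] by (simp add: abs_mult)
  also have "\<dots> \<le> (R / r - 1) * norm (x - y) + (R / r - 1) * (R\<^sup>2 / r) * (norm (x - y) / r)
      + R * (norm (x - y) / r)"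
  proof (intro add_mono)
    show "m u * \<bar>norm x - norm y\<bar> \<le> (R / r - 1) * norm (x - y)"
      using slope_le[OF unit(1)] a by (intro mult_mono norm_triangle_ineq3) auto
    have "(norm y - r) * \<bar>m u - m v\<bar> \<le> (R / r - 1) * (R\<^sup>2 / r) * norm (u - v)"
      using slope_variation[OF y unit(1)] by (simp add: v_def)
    also have "\<dots> \<le> (R / r - 1) * (R\<^sup>2 / r) * (norm (x - y) / r)"
      using angle a r_pos by (intro mult_left_mono mult_nonneg_nonneg) (auto simp: le_divide_eq)
    finally show "(norm y - r) * \<bar>m u - m v\<bar> \<le> (R / r - 1) * (R\<^sup>2 / r) * (norm (x - y) / r)" .
    have "norm (f y) \<le> R"
      using norm_radial_map_le[OF y] radial_bounds(4)[OF unit(2)] by (simp add: v_def)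
    then show "norm (f y) * norm (u - v) \<le> R * (norm (x - y) / r)"
      using angle \<open>R > 0\<close> by (intro mult_mono) auto
  qed
  also have "\<dots> = (R / r - 1 + (R / r - 1) * (R / r)\<^sup>2 + R / r) * norm (x - y)"
    using r_pos by (simp add: field_simps power2_eq_square)
  finally show ?thesis .
qed

lemma radial_map_lipschitz_mixed:
  assumes x: "norm x \<le> r" and y: "r \<le> norm y"
  shows "norm (f x - f y) \<le> R / r * norm (x - y)"
proof -
  have unit: "norm (sgn y) = 1"
    using y r_pos by (auto simp: norm_sgn)
  have "f x - f y = (x - r *\<^sub>R sgn y) - ((norm y - r) * m (sgn y)) *\<^sub>R sgn y"
    using x y r_pos by (simp add: radial_map_inside radial_map_outside scaleR_add_left)
  then have "norm (f x - f y) \<le> norm (x - r *\<^sub>R sgn y) + norm (((norm y - r) * m (sgn y)) *\<^sub>R sgn y)"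
    by (simp only: norm_triangle_ineq4)
  also have "\<dots> = norm (x - r *\<^sub>R sgn y) + (norm y - r) * m (sgn y)"
    using unit y slope_pos[OF unit] by simp
  also have "\<dots> \<le> norm (x - y) + norm (x - y) * (R / r - 1)"
  proof (intro add_mono mult_mono)
    show "norm (x - r *\<^sub>R sgn y) \<le> norm (x - y)"
      using x y r_pos by (intro norm_diff_project_ball_le)
    show "norm y - r \<le> norm (x - y)"
      using x norm_triangle_ineq2[of y x] by (simp add: norm_minus_commute)
    show "m (sgn y) \<le> R / r - 1"
      by (rule slope_le[OF unit])
  qed (use slope_pos[OF unit] in auto)
  also have "\<dots> = R / r * norm (x - y)"
    by (simp add: algebra_simps)
  finally show ?thesis .
qed

lemma radial_map_lipschitz:
  "(1 + R / r * (R / r - 1) * (R\<^sup>2 / r\<^sup>2 + 1))-lipschitz_on C f"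
proof -
  define a where "a = R / r"
  define K where "K = a - 1 + (a - 1) * a\<^sup>2 + a"
  have a: "2 \<le> a"
    unfolding a_def by (rule two_le_ratio)
  have "0 \<le> (a - 1) * a\<^sup>2"
    using a by (intro mult_nonneg_nonneg) auto
  then have K: "a \<le> K"
    using a unfolding K_def by linarith
  have "dist (f x) (f y) \<le> K * dist x y" if "x \<in> C" "y \<in> C" for x y
  proof -
    consider (inside) "norm x \<le> r" "norm y \<le> r" | (out) "r \<le> norm x" "r \<le> norm y"
      | (left) "norm x \<le> r" "r \<le> norm y" | (right) "r \<le> norm x" "norm y \<le> r"
      by linarith
    then have "norm (f x - f y) \<le> K * norm (x - y)"
    proof cases
      case inside
      then show ?thesis
        using K a mult_right_mono[of 1 K "norm (x - y)"] by (simp add: radial_map_inside)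
    next
      case out
      then show ?thesis
        using radial_map_lipschitz_outside that by (simp add: K_def a_def)
    next
      case left
      then have "norm (f x - f y) \<le> a * norm (x - y)"
        unfolding a_def by (rule radial_map_lipschitz_mixed)
      also have "\<dots> \<le> K * norm (x - y)"
        using K by (intro mult_right_mono) auto
      finally show ?thesis .
    next
      case right
      then have "norm (f y - f x) \<le> a * norm (y - x)"
        unfolding a_def by (intro radial_map_lipschitz_mixed)
      also have "\<dots> \<le> K * norm (y - x)"
        using K by (intro mult_right_mono) auto
      finally show ?thesis
        by (simp add: norm_minus_commute)
    qed
    then show ?thesis
      by (simp add: dist_norm)
  qed
  then have lip: "K-lipschitz_on C f"
    using K a by (simp add: lipschitz_on_def)
  have "K \<le> 1 + a * (a - 1) * (a\<^sup>2 + 1)"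
  proof -
    \<comment> \<open>The two sides are \<open>1 + (a - 1) * (a\<^sup>2 + 2)\<close> and \<open>1 + (a - 1) * (a * (a\<^sup>2 + 1))\<close>.\<close>
    have "a\<^sup>2 + 2 \<le> 2 * (a\<^sup>2 + 1)"
      by simp
    also have "\<dots> \<le> a * (a\<^sup>2 + 1)"
      using a by (intro mult_right_mono) auto
    finally have "(a - 1) * (a\<^sup>2 + 2) \<le> (a - 1) * (a * (a\<^sup>2 + 1))"
      using a by (intro mult_left_mono) auto
    then show ?thesis
      by (simp add: K_def algebra_simps)
  qed
  then show ?thesis
    using lipschitz_on_le[OF lip] by (simp add: a_def power_divide)
qed

lemma one_le_Lip_radial_map: "1 \<le> Lip C f"
proof (rule one_le_Lip_if_fixes_ball[OF radial_map_lipschitz r_pos])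
  show "cball 0 r \<subseteq> C"
    using inner_ball(1) r_pos by auto
qed (rule radial_map_inside)

end

theorem corollary3p9:
  fixes C C' :: "'a::euclidean_space set" and r R :: real and f :: "'a \<Rightarrow> 'a"
  assumes "0 < r" and "r < R"
    and "convex_body C" and "convex_body C'"
    and "cball 0 (2 * r) \<subseteq> C \<inter> C'"
    and "C \<union> C' \<subseteq> cball 0 R"
  defines "f \<equiv> radial_map r C C'"
  shows "bilipschitz C C' f
    \<and> 1 \<le> Lip C f
    \<and> Lip C f \<le> 1 + R / r * (R / r - 1) * (R\<^sup>2 / r\<^sup>2 + 1)
    \<and> 1 \<le> Lip C' (inv_into C f)
    \<and> Lip C' (inv_into C f) \<le> 1 + R / r * (R / r - 1) * (R\<^sup>2 / r\<^sup>2 + 1)"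
proof -
  let ?g = "radial_map r C' C"
  let ?L = "1 + R / r * (R / r - 1) * (R\<^sup>2 / r\<^sup>2 + 1)"
  interpret A: pinched_bodies C C' r R
    using assms by unfold_locales (auto simp: convex_body_def)
  interpret B: pinched_bodies C' C r R
    by (rule A.swap)
  have bij: "bij_betw f C C'"
    unfolding f_def
    by (rule bij_betw_byWitness[where f' = ?g])
      (auto simp: A.radial_map_inverse B.radial_map_inverse A.radial_map_mem B.radial_map_mem)
  have inv: "inv_into C f y = ?g y" if "y \<in> C'" for y
  proof (rule inv_into_f_eq[OF bij_betw_imp_inj_on[OF bij]])
    show "?g y \<in> C" "f (?g y) = y"
      using that by (simp_all add: f_def B.radial_map_mem B.radial_map_inverse)
  qed
  have lip: "?L-lipschitz_on C f"
    unfolding f_def by (rule A.radial_map_lipschitz)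
  have inv_lip: "K-lipschitz_on C' (inv_into C f) \<longleftrightarrow> K-lipschitz_on C' ?g" for K
    using inv by (simp add: lipschitz_on_def)
  have Lip_inv: "Lip C' (inv_into C f) = Lip C' ?g"
    by (simp add: Lip_def inv_lip)
  have "bilipschitz C C' f"
    unfolding bilipschitz_def using bij lip inv_lip B.radial_map_lipschitz by blast
  then show ?thesis
    unfolding Lip_inv
    using A.one_le_Lip_radial_map B.one_le_Lip_radial_map Lip_attained(2)[OF lip]
      Lip_attained(2)[OF B.radial_map_lipschitz]
    by (simp add: f_def)
qed

end
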